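(* Let $(E,\mathcal S,c,r)$ be an MDSC instance with $n=|E|\ge 32$ and $r_{\max}=\max_{e\in E}r_e$. Algorithm 2 (described in the context) outputs a sub-collection $\mathcal S'$ with $\frac{c(\mathcal S')}{|\mathcal C(\mathcal S')|}\le O(r_{\max}(\log n)^2)\cdot opt_{MDSC}$, where $opt_{MDSC}$ is the minimum density.
   Context: For $\mathcal S'\subseteq\mathcal S$, $e$ is fully covered by $\mathcal S'$ if at least $r_e$ sets of $\mathcal S'$ contain $e$; $\mathcal C(\mathcal S')$ is the set of fully covered elements, $c(\mathcal S')=\sum_{S\in\mathcal S'}c_S$; MDSC asks to minimize $c(\mathcal S')/|\mathcal C(\mathcal S')|$. For $e\in E$, $\Omega_e$ is the family of sub-collections $Q\subseteq\mathcal S$ with $|Q|=r_e$ all of whose sets contain $e$ (copies in different $\Omega_e$ are distinct). LP$_1$: minimize $\sum_S c_Sx_S$ subject to $\sum_e y_e=1$, $\sum_{Q\in\Omega_e}l_Q\ge y_e$ for all $e$, $x_S\ge\sum_{Q\colon S\in Q\in\Omega_e}l_Q$ for all $e,S$, and $x,y,l\ge0$. Node-weighted Steiner network (NWSN): given a graph with node weights and connectivity requirements $r_{s,t}$, find a minimum-weight subgraph in which each pair $s,t$ is joined by $r_{s,t}$ edge-disjoint paths; its LP relaxation has, for each pair, variables $l_P$ over sets $P$ of $r_{s,t}$ edge-disjoint $(s,t)$-paths with $\sum_P l_P\ge1$, and node variables $x_v\ge\sum_{P\ni v}l_P$, minimizing $\sum_v c_vx_v$. Algorithm 2: (1) compute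 an optimal solution $(x^f,y^f,l^f)$ of LP$_1$; (2) with $I=2\lfloor\log n\rfloor-1$, let $Y_i=\{e\colon 2^{-(i+1)}<y^f_e\le 2^{-i}\}$ for $0\le i\le I-1$ and $Y_I=\{e\colon y^f_e\le 2^{-I}\}$; (3) choose $i_0$ with $|Y_{i_0}|\ge 2^{i_0}/(I+1)$; (4) build the graph $H$ on nodes $Y_{i_0}\cup\mathcal S\cup\{s\}$ with edges $eS$ for $e\in Y_{i_0}$, $e\in S\in\mathcal S$, and $sS$ for all $S\in\mathcal S$, node weight $c_S$ on $S\in\mathcal S$ and $0$ elsewhere, requirement $r_{s,e}=r_e$ for $e\in Y_{i_0}$ and $0$ otherwise, and compute a solution $H'$ to this NWSN instance using an NWSN approximation algorithm whose output weight is within $O(r_{\max}\log n)$ of the optimum of the NWSN LP relaxation (as given by Chekuri et al.); (5) output $\mathcal S'=V(H')\setminus(Y_{i_0}\cup\{s\})$.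
   Formalization: In step (3) the choice i_0 = I is excluded when 52 ≤ n ≤ 63, since Y_I may then qualify although its elements have y = 0, and the bound fails; an admissible i_0 < I is proved to exist always, and the bound is proved for every other admissible i_0. *)

theory Defs
  imports Complex_Main
begin

section \<open>Minimum density set multicover\<close>

definition covered :: "'a set \<Rightarrow> ('a \<Rightarrow> nat) \<Rightarrow> 'a set set \<Rightarrow> 'a set" where
  "covered E r \<S>' = {e \<in> E. r e \<le> card {S \<in> \<S>'. e \<in> S}}"

definition cost :: "('a set \<Rightarrow> real) \<Rightarrow> 'a set set \<Rightarrow> real" where
  "cost c \<S>' = (\<Sum>S\<in>\<S>'. c S)"

definition density :: "'a set \<Rightarrow> ('a set \<Rightarrow> real) \<Rightarrow> ('a \<Rightarrow> nat) \<Rightarrow> 'a set set \<Rightarrow> real" where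
  "density E c r \<S>' = cost c \<S>' / real (card (covered E r \<S>'))"

text \<open>The last conjunct says that some element can be fully covered at all; without it no
  sub-collection has a density.\<close>

definition mdsc_instance ::
  "'a set \<Rightarrow> 'a set set \<Rightarrow> ('a set \<Rightarrow> real) \<Rightarrow> ('a \<Rightarrow> nat) \<Rightarrow> bool" where
  "mdsc_instance E \<S> c r \<longleftrightarrow>
     finite E \<and> \<S> \<subseteq> Pow E \<and> (\<forall>S\<in>\<S>. 0 \<le> c S) \<and> covered E r \<S> \<noteq> {}"

text \<open>Sub-collections covering nothing are excluded: division by zero would give them density 0.\<close>

definition opt_mdsc ::
  "'a set \<Rightarrow> 'a set set \<Rightarrow> ('a set \<Rightarrow> real) \<Rightarrow> ('a \<Rightarrow> nat) \<Rightarrow> real" where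
  "opt_mdsc E \<S> c r = Min {density E c r \<S>' | \<S>'. \<S>' \<subseteq> \<S> \<and> covered E r \<S>' \<noteq> {}}"

definition r_max :: "'a set \<Rightarrow> ('a \<Rightarrow> nat) \<Rightarrow> nat" where
  "r_max E r = Max (r ` E)"


section \<open>The linear program LP1\<close>

definition Omega :: "'a set set \<Rightarrow> ('a \<Rightarrow> nat) \<Rightarrow> 'a \<Rightarrow> 'a set set set" where
  "Omega \<S> r e = {Q. Q \<subseteq> \<S> \<and> card Q = r e \<and> (\<forall>S\<in>Q. e \<in> S)}"

text \<open>The variables \<open>l\<close> carry the element as an extra index, so that copies of the same \<open>Q\<close>
  belonging to different elements are distinct.\<close>

definition lp1_feasible ::
  "'a set \<Rightarrow> 'a set set \<Rightarrow> ('a \<Rightarrow> nat) \<Rightarrow>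
    ('a set \<Rightarrow> real) \<Rightarrow> ('a \<Rightarrow> real) \<Rightarrow> ('a \<Rightarrow> 'a set set \<Rightarrow> real) \<Rightarrow> bool" where
  "lp1_feasible E \<S> r x y l \<longleftrightarrow>
     (\<Sum>e\<in>E. y e) = 1 \<and>
     (\<forall>e\<in>E. y e \<le> (\<Sum>Q\<in>Omega \<S> r e. l e Q)) \<and>
     (\<forall>e\<in>E. \<forall>S\<in>\<S>. (\<Sum>Q\<in>{Q \<in> Omega \<S> r e. S \<in> Q}. l e Q) \<le> x S) \<and>
     (\<forall>S\<in>\<S>. 0 \<le> x S) \<and> (\<forall>e\<in>E. 0 \<le> y e) \<and> (\<forall>e\<in>E. \<forall>Q\<in>Omega \<S> r e. 0 \<le> l e Q)"

definition lp1_optimal ::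
  "'a set \<Rightarrow> 'a set set \<Rightarrow> ('a set \<Rightarrow> real) \<Rightarrow> ('a \<Rightarrow> nat) \<Rightarrow>
    ('a set \<Rightarrow> real) \<Rightarrow> ('a \<Rightarrow> real) \<Rightarrow> ('a \<Rightarrow> 'a set set \<Rightarrow> real) \<Rightarrow> bool" where
  "lp1_optimal E \<S> c r x y l \<longleftrightarrow>
     lp1_feasible E \<S> r x y l \<and>
     (\<forall>x' y' l'. lp1_feasible E \<S> r x' y' l' \<longrightarrow> (\<Sum>S\<in>\<S>. c S * x S) \<le> (\<Sum>S\<in>\<S>. c S * x' S))"


section \<open>Node-weighted Steiner network\<close>

text \<open>Graphs are undirected and simple: a set of nodes together with a set of two-element node
  sets. Requirements are indexed by ordered pairs of distinct nodes.\<close>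

type_synonym 'v ugraph = "'v set \<times> 'v set set"

record 'v nwsn =
  graph :: "'v ugraph"
  node_weight :: "'v \<Rightarrow> real"
  req :: "'v \<Rightarrow> 'v \<Rightarrow> nat"

definition subgraph :: "'v ugraph \<Rightarrow> 'v ugraph \<Rightarrow> bool" where
  "subgraph H G \<longleftrightarrow> fst H \<subseteq> fst G \<and> snd H \<subseteq> snd G \<and> (\<forall>a\<in>snd H. a \<subseteq> fst H)"

definition path_edges :: "'v list \<Rightarrow> 'v set set" where
  "path_edges p = {{p ! i, p ! Suc i} | i. Suc i < length p}"

definition is_path :: "'v ugraph \<Rightarrow> 'v \<Rightarrow> 'v \<Rightarrow> 'v list \<Rightarrow> bool" where
  "is_path G u v p \<longleftrightarrow>
     p \<noteq> [] \<and> hd p = u \<and> last p = v \<and> distinct p \<and> set p \<subseteq> fst G \<and> path_edges p \<subseteq> snd G"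

definition disjoint_path_sets :: "'v ugraph \<Rightarrow> nat \<Rightarrow> 'v \<Rightarrow> 'v \<Rightarrow> 'v list set set" where
  "disjoint_path_sets G k u v =
     {P. finite P \<and> card P = k \<and> (\<forall>p\<in>P. is_path G u v p) \<and>
         (\<forall>p\<in>P. \<forall>q\<in>P. p \<noteq> q \<longrightarrow> path_edges p \<inter> path_edges q = {})}"

definition nwsn_solution :: "'v nwsn \<Rightarrow> 'v ugraph \<Rightarrow> bool" where
  "nwsn_solution N H \<longleftrightarrow>
     subgraph H (graph N) \<and>
     (\<forall>u\<in>fst (graph N). \<forall>v\<in>fst (graph N).
        u \<noteq> v \<longrightarrow> disjoint_path_sets H (req N u v) u v \<noteq> {})"

definition subgraph_weight :: "'v nwsn \<Rightarrow> 'v ugraph \<Rightarrow> real" where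
  "subgraph_weight N H = (\<Sum>v\<in>fst H. node_weight N v)"

definition nwsn_lp_feasible ::
  "'v nwsn \<Rightarrow> ('v \<Rightarrow> real) \<Rightarrow> ('v \<Rightarrow> 'v \<Rightarrow> 'v list set \<Rightarrow> real) \<Rightarrow> bool" where
  "nwsn_lp_feasible N x l \<longleftrightarrow>
     (\<forall>v\<in>fst (graph N). 0 \<le> x v) \<and>
     (\<forall>s\<in>fst (graph N). \<forall>t\<in>fst (graph N). s \<noteq> t \<longrightarrow>
        (let \<P> = disjoint_path_sets (graph N) (req N s t) s t in
          (\<forall>P\<in>\<P>. 0 \<le> l s t P) \<and>
          1 \<le> (\<Sum>P\<in>\<P>. l s t P) \<and>
          (\<forall>v\<in>fst (graph N). (\<Sum>P\<in>{P \<in> \<P>. \<exists>p\<in>P. v \<in> set p}. l s t P) \<le> x v)))"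

definition nwsn_lp_opt :: "'v nwsn \<Rightarrow> real" where
  "nwsn_lp_opt N =
     Inf {(\<Sum>v\<in>fst (graph N). node_weight N v * x v) | x l. nwsn_lp_feasible N x l}"

definition nwsn_approximates :: "('v nwsn \<Rightarrow> 'v ugraph) \<Rightarrow> real \<Rightarrow> 'v nwsn \<Rightarrow> bool" where
  "nwsn_approximates solver \<rho> N \<longleftrightarrow>
     (\<exists>H. nwsn_solution N H) \<longrightarrow>
       nwsn_solution N (solver N) \<and> subgraph_weight N (solver N) \<le> \<rho> * nwsn_lp_opt N"


section \<open>The algorithm\<close>

definition last_class :: "nat \<Rightarrow> nat" where
  "last_class n = nat (2 * \<lfloor>log 2 (real n)\<rfloor> - 1)"

definition Y_class :: "'a set \<Rightarrow> ('a \<Rightarrow> real) \<Rightarrow> nat \<Rightarrow> 'a set" where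
  "Y_class E y i =
     (if i < last_class (card E) then {e \<in> E. 1 / 2 ^ (i + 1) < y e \<and> y e \<le> 1 / 2 ^ i}
      else {e \<in> E. y e \<le> 1 / 2 ^ last_class (card E)})"

text \<open>For \<open>n = |E| \<ge> 32\<close> the residual class \<open>i = last_class n\<close>, whose elements may have
  \<open>y e = 0\<close>, is admissible only if \<open>2 ^ last_class n / (last_class n + 1) \<le> n\<close>, that is, only for
  \<open>52 \<le> n \<le> 63\<close>. For these \<open>n\<close> covering the residual class can be arbitrarily more expensive
  than the optimum.\<close>

definition admissible_class :: "'a set \<Rightarrow> ('a \<Rightarrow> real) \<Rightarrow> nat \<Rightarrow> bool" where
  "admissible_class E y i \<longleftrightarrow>
     i \<le> last_class (card E) \<and>
     real (card (Y_class E y i)) \<ge> 2 ^ i / (real (last_class (card E)) + 1)"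

datatype 'a hnode = Elem 'a | Coll "'a set" | Root

fun h_weight :: "('a set \<Rightarrow> real) \<Rightarrow> 'a hnode \<Rightarrow> real" where
  "h_weight c (Coll S) = c S"
| "h_weight c _ = 0"

fun h_req :: "'a set \<Rightarrow> ('a \<Rightarrow> nat) \<Rightarrow> 'a hnode \<Rightarrow> 'a hnode \<Rightarrow> nat" where
  "h_req Y r Root (Elem e) = (if e \<in> Y then r e else 0)"
| "h_req Y r _ _ = 0"

definition h_instance ::
  "'a set set \<Rightarrow> ('a set \<Rightarrow> real) \<Rightarrow> ('a \<Rightarrow> nat) \<Rightarrow> 'a set \<Rightarrow> 'a hnode nwsn" where
  "h_instance \<S> c r Y =
     \<lparr> graph = (Elem ` Y \<union> Coll ` \<S> \<union> {Root},
                {{Elem e, Coll S} | e S. e \<in> Y \<and> S \<in> \<S> \<and> e \<in> S} \<union> {{Root, Coll S} | S. S \<in> \<S>}),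
       node_weight = h_weight c,
       req = h_req Y r \<rparr>"

definition alg2_output ::
  "('a hnode nwsn \<Rightarrow> 'a hnode ugraph) \<Rightarrow> 'a set \<Rightarrow> 'a set set \<Rightarrow> ('a set \<Rightarrow> real) \<Rightarrow>
    ('a \<Rightarrow> nat) \<Rightarrow> ('a \<Rightarrow> real) \<Rightarrow> nat \<Rightarrow> 'a set set" where
  "alg2_output solver E \<S> c r y i =
     (let Y = Y_class E y i; H' = solver (h_instance \<S> c r Y)
      in {S. Coll S \<in> fst H' - (Elem ` Y \<union> {Root})})"

end

theory Submission
  imports Defs "HOL-Analysis.Function_Topology"
begin

text \<open>An optimal sub-collection, spread uniformly over the elements it covers, is a solution of LP1,
  so the LP optimum is at most the minimum density. Every element of an admissible class \<open>Y\<^sub>i\<close> with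
  \<open>i < I\<close> has \<open>y e > 2 ^ -(i+1)\<close>, so scaling the LP solution by \<open>2 ^ (i+1)\<close> gives a fractional solution
  of the network instance. Its integral solution thus costs at most \<open>\<rho> * 2 ^ (i+1)\<close> times the
  LP optimum and covers at least \<open>2 ^ i / (I+1)\<close> elements, and \<open>I + 1 \<le> 2 * log 2 n\<close>.\<close>

section \<open>Optimal solutions of the linear program\<close>

lemma finite_Omega: "finite \<S> \<Longrightarrow> finite (Omega \<S> r e)"
  by (rule finite_subset[of _ "Pow \<S>"]) (auto simp: Omega_def)

lemma finite_collection: "mdsc_instance E \<S> c r \<Longrightarrow> finite \<S>"
  unfolding mdsc_instance_def by (metis finite_Pow_iff finite_subset)

text \<open>With \<open>N\<close> covered elements, each gets \<open>y\<close>-mass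
  \<open>1 / N\<close>, carried entirely by one chosen \<open>r e\<close>-subset of the sets
  containing it. Then \<open>x = 1 / N\<close> on \<open>\<S>'\<close> meets every constraint, and
  the objective is exactly cost over \<open>N\<close>.\<close>

lemma lp1_feasible_of_cover:
  assumes inst: "mdsc_instance E \<S> c r" and sub: "\<S>' \<subseteq> \<S>" and ne: "covered E r \<S>' \<noteq> {}"
  shows "\<exists>x y l. lp1_feasible E \<S> r x y l \<and> (\<Sum>S\<in>\<S>. c S * x S) = density E c r \<S>'"
proof -
  define C where "C = covered E r \<S>'"
  define N where "N = real (card C)"
  have finE: "finite E" using inst by (simp add: mdsc_instance_def)
  have finS: "finite \<S>" using inst by (rule finite_collection)
  have CE: "C \<subseteq> E" by (auto simp: C_def covered_def)
  have finC: "finite C" using CE finE by (rule finite_subset)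
  have N: "N > 0" using ne finC by (simp add: N_def C_def card_gt_0_iff)
  have "\<forall>e\<in>C. \<exists>Q. Q \<subseteq> {S \<in> \<S>'. e \<in> S} \<and> card Q = r e"
  proof
    fix e assume "e \<in> C"
    then have "r e \<le> card {S \<in> \<S>'. e \<in> S}" by (simp add: C_def covered_def)
    then show "\<exists>Q. Q \<subseteq> {S \<in> \<S>'. e \<in> S} \<and> card Q = r e"
      by (rule obtain_subset_with_card_n) blast
  qed
  then obtain q where q: "\<And>e. e \<in> C \<Longrightarrow> q e \<subseteq> {S \<in> \<S>'. e \<in> S} \<and> card (q e) = r e"
    by metis
  have qO: "q e \<in> Omega \<S> r e" if "e \<in> C" for e
    using q[OF that] sub by (auto simp: Omega_def)
  define x where "x S = (if S \<in> \<S>' then 1 / N else 0)" for S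
  define y where "y e = (if e \<in> C then 1 / N else 0)" for e
  define l where "l e Q = (if Q = q e then y e else 0)" for e Q
  have "(\<Sum>e\<in>E. y e) = (\<Sum>e\<in>C. 1 / N)"
    using CE finE by (simp add: y_def sum.If_cases Int_absorb1)
  then have "(\<Sum>e\<in>E. y e) = 1" using N by (simp add: N_def)
  moreover have "y e \<le> (\<Sum>Q\<in>Omega \<S> r e. l e Q)" for e
    using qO[of e] finite_Omega[OF finS, of r e] by (simp add: l_def y_def)
  moreover have "(\<Sum>Q\<in>{Q \<in> Omega \<S> r e. S \<in> Q}. l e Q) \<le> x S" for e S
    using q[of e] finite_Omega[OF finS, of r e] N by (auto simp: l_def x_def y_def)
  ultimately have "lp1_feasible E \<S> r x y l"
    using N by (simp add: lp1_feasible_def x_def y_def l_def)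
  moreover have "(\<Sum>S\<in>\<S>. c S * x S) = (\<Sum>S\<in>\<S>'. c S * (1 / N))"
    using sub finS by (intro sum.mono_neutral_cong_right) (auto simp: x_def)
  then have "(\<Sum>S\<in>\<S>. c S * x S) = density E c r \<S>'"
    by (simp add: density_def cost_def N_def C_def sum_divide_distrib)
  ultimately show ?thesis by blast
qed

text \<open>Every competitor in the minimum density yields a feasible point of LP1 with that density
  as objective value.\<close>

lemma lp1_optimal_le_opt_mdsc:
  assumes inst: "mdsc_instance E \<S> c r" and opt: "lp1_optimal E \<S> c r x y l"
  shows "(\<Sum>S\<in>\<S>. c S * x S) \<le> opt_mdsc E \<S> c r"
proof -
  let ?D = "{density E c r \<S>' | \<S>'. \<S>' \<subseteq> \<S> \<and> covered E r \<S>' \<noteq> {}}"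
  have "?D \<subseteq> density E c r ` Pow \<S>" by auto
  then have "finite ?D"
    by (rule finite_subset) (simp add: finite_collection[OF inst])
  moreover have "?D \<noteq> {}" using inst by (auto simp: mdsc_instance_def)
  moreover have "(\<Sum>S\<in>\<S>. c S * x S) \<le> d" if "d \<in> ?D" for d
  proof -
    obtain \<S>' where "d = density E c r \<S>'" "\<S>' \<subseteq> \<S>" "covered E r \<S>' \<noteq> {}"
      using \<open>d \<in> ?D\<close> by blast
    moreover from lp1_feasible_of_cover[OF inst this(2,3)] obtain x' y' l'
      where "lp1_feasible E \<S> r x' y' l'" "(\<Sum>S\<in>\<S>. c S * x' S) = density E c r \<S>'" by blast
    ultimately show ?thesis using opt unfolding lp1_optimal_def by metis
  qed
  ultimately show ?thesis unfolding opt_mdsc_def by simp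
qed

section \<open>Existence of an LP1 optimum by compactness\<close>

lemma compact_unit_cube: "compact {z :: 'i \<Rightarrow> real. \<forall>i. z i \<in> {0..1}}"
proof -
  have "compactin (product_topology (\<lambda>_. euclidean) UNIV) (PiE (UNIV :: 'i set) (\<lambda>_. {0..1::real}))"
    by (simp add: compactin_PiE)
  moreover have "PiE (UNIV :: 'i set) (\<lambda>_. {0..1::real}) = {z. \<forall>i. z i \<in> {0..1}}"
    by (auto simp: PiE_def)
  ultimately show ?thesis by (simp add: euclidean_product_topology)
qed

text \<open>Multiplying \<open>l e Q\<close> by \<open>y e / L e\<close>, a factor at most 1, turns
  \<open>y e \<le> L e\<close> into an equality, so \<open>y\<close> ceases to be an independent
  variable. The \<open>l\<close>-mass of each element is then at most 1, so \<open>x\<close> may be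
  cut off at 1. Values outside the relevant index sets become 0 to place the whole functions in the
  cube.\<close>

lemma lp1_feasible_scale_down:
  assumes inst: "mdsc_instance E \<S> c r" and feas: "lp1_feasible E \<S> r x y l"
  obtains x' l' where "\<And>S. x' S \<in> {0..1::real}" "\<And>e Q. l' e Q \<in> {0..1::real}"
    "lp1_feasible E \<S> r x' (\<lambda>e. \<Sum>Q\<in>Omega \<S> r e. l' e Q) l'"
    "(\<Sum>S\<in>\<S>. c S * x' S) \<le> (\<Sum>S\<in>\<S>. c S * x S)"
proof -
  have finE: "finite E" and c: "\<And>S. S \<in> \<S> \<Longrightarrow> 0 \<le> c S"
    using inst by (auto simp: mdsc_instance_def)
  have finO: "finite (Omega \<S> r e)" for e
    using finite_Omega[OF finite_collection[OF inst]] .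
  have y1: "(\<Sum>e\<in>E. y e) = 1" and yl: "\<And>e. e \<in> E \<Longrightarrow> y e \<le> (\<Sum>Q\<in>Omega \<S> r e. l e Q)"
    and lx: "\<And>e S. e \<in> E \<Longrightarrow> S \<in> \<S> \<Longrightarrow> (\<Sum>Q\<in>{Q \<in> Omega \<S> r e. S \<in> Q}. l e Q) \<le> x S"
    and x0: "\<And>S. S \<in> \<S> \<Longrightarrow> 0 \<le> x S" and y0: "\<And>e. e \<in> E \<Longrightarrow> 0 \<le> y e"
    and l0: "\<And>e Q. e \<in> E \<Longrightarrow> Q \<in> Omega \<S> r e \<Longrightarrow> 0 \<le> l e Q"
    using feas by (auto simp: lp1_feasible_def)
  have yle1: "y e \<le> 1" if "e \<in> E" for e
    using member_le_sum[of e E y] that y0 finE y1 by auto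
  define L where "L e = (\<Sum>Q\<in>Omega \<S> r e. l e Q)" for e
  define x' where "x' S = (if S \<in> \<S> then min 1 (x S) else 0)" for S
  define l' where "l' e Q = (if e \<in> E \<and> Q \<in> Omega \<S> r e then l e Q * (y e / L e) else 0)" for e Q
  have ratio: "0 \<le> y e / L e" "y e / L e \<le> 1" if "e \<in> E" for e
    using y0[OF that] yl[OF that] by (auto simp: L_def[symmetric] divide_le_eq_1)
  have l'l: "l' e Q \<le> l e Q" if "e \<in> E" "Q \<in> Omega \<S> r e" for e Q
    using mult_left_le[OF ratio(2)[OF that(1)] l0[OF that]] that by (simp add: l'_def)
  have l'0: "0 \<le> l' e Q" for e Q
    using mult_nonneg_nonneg[OF l0[of e Q] ratio(1)[of e]] by (auto simp: l'_def)
  have sum_l': "(\<Sum>Q\<in>Omega \<S> r e. l' e Q) = y e" if "e \<in> E" for e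
  proof -
    have "(\<Sum>Q\<in>Omega \<S> r e. l' e Q) = L e * (y e / L e)"
      unfolding L_def sum_distrib_right by (rule sum.cong) (auto simp: l'_def that L_def)
    \<comment> \<open>For \<open>L e = 0\<close> the quotient \<open>y e / L e\<close> is 0 by
      convention; the identity survives because \<open>y e \<le> L e\<close> forces
      \<open>y e = 0\<close>.\<close>
    moreover have "L e = 0 \<Longrightarrow> y e = 0"
      using yl[OF that] y0[OF that] by (simp add: L_def)
    ultimately show ?thesis by auto
  qed
  have part: "(\<Sum>Q\<in>{Q \<in> Omega \<S> r e. S \<in> Q}. l' e Q) \<le> min 1 (x S)" if "e \<in> E" "S \<in> \<S>" for e S
  proof -
    have "(\<Sum>Q\<in>{Q \<in> Omega \<S> r e. S \<in> Q}. l' e Q) \<le> (\<Sum>Q\<in>Omega \<S> r e. l' e Q)"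
      by (rule sum_mono2) (auto simp: finO l'0)
    moreover have "(\<Sum>Q\<in>{Q \<in> Omega \<S> r e. S \<in> Q}. l' e Q) \<le> (\<Sum>Q\<in>{Q \<in> Omega \<S> r e. S \<in> Q}. l e Q)"
      by (rule sum_mono) (simp add: l'l that)
    ultimately show ?thesis
      using sum_l' yle1 lx that by fastforce
  qed
  show ?thesis
  proof (rule that)
    show "x' S \<in> {0..1}" for S using x0 by (auto simp: x'_def)
    show "l' e Q \<in> {0..1}" for e Q
    proof (cases "e \<in> E \<and> Q \<in> Omega \<S> r e")
      case True
      then have "l' e Q \<le> (\<Sum>Q\<in>Omega \<S> r e. l' e Q)"
        by (intro member_le_sum) (auto simp: l'0 finO)
      then show ?thesis using True sum_l' yle1 l'0 by fastforce
    qed (auto simp: l'_def)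
    show "lp1_feasible E \<S> r x' (\<lambda>e. \<Sum>Q\<in>Omega \<S> r e. l' e Q) l'"
      using part x0 y0 l'0 y1 by (auto simp: lp1_feasible_def sum_l' x'_def)
    show "(\<Sum>S\<in>\<S>. c S * x' S) \<le> (\<Sum>S\<in>\<S>. c S * x S)"
      by (rule sum_mono) (simp add: x'_def c mult_left_mono)
  qed
qed

text \<open>Truncating \<open>x\<close> at 1 and scaling \<open>l\<close> down to \<open>\<Sum>Q. l e Q = y e\<close> never increases the objective,
  so it suffices to minimise over a closed subset of a cube.\<close>

lemma lp1_optimal_exists:
  assumes inst: "mdsc_instance E \<S> c r"
  shows "\<exists>x y l. lp1_optimal E \<S> c r x y l"
proof -
  \<comment> \<open>A single function \<open>z\<close> on a sum type stores \<open>x\<close> under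
    \<open>Inl\<close> and \<open>l\<close> under \<open>Inr\<close>; \<open>y\<close> is recovered
    as the sum \<open>Y z\<close>.\<close>
  define Y where "Y z e = (\<Sum>Q\<in>Omega \<S> r e. z (Inr (e, Q)))"
    for z :: "'a set + 'a \<times> 'a set set \<Rightarrow> real" and e
  define F where "F = {z :: 'a set + 'a \<times> 'a set set \<Rightarrow> real. \<forall>i. z i \<in> {0..1}} \<inter>
     ({z. (\<Sum>e\<in>E. Y z e) = 1} \<inter>
      (\<Inter>e\<in>E. \<Inter>S\<in>\<S>. {z. (\<Sum>Q\<in>{Q \<in> Omega \<S> r e. S \<in> Q}. z (Inr (e, Q))) \<le> z (Inl S)}))"
  define obj where "obj z = (\<Sum>S\<in>\<S>. c S * z (Inl S))" for z :: "'a set + 'a \<times> 'a set set \<Rightarrow> real"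
  have feasF: "lp1_feasible E \<S> r (\<lambda>S. z (Inl S)) (Y z) (\<lambda>e Q. z (Inr (e, Q)))" if "z \<in> F" for z
    using that by (auto simp: F_def lp1_feasible_def Y_def intro!: sum_nonneg)
  have toF: "\<exists>z\<in>F. obj z \<le> (\<Sum>S\<in>\<S>. c S * x S)" if feas: "lp1_feasible E \<S> r x y l" for x y l
  proof -
    obtain x' l' where *: "\<And>S. x' S \<in> {0..1::real}" "\<And>e Q. l' e Q \<in> {0..1::real}"
      "lp1_feasible E \<S> r x' (\<lambda>e. \<Sum>Q\<in>Omega \<S> r e. l' e Q) l'"
      "(\<Sum>S\<in>\<S>. c S * x' S) \<le> (\<Sum>S\<in>\<S>. c S * x S)"
      using lp1_feasible_scale_down[OF inst feas] by blast
    define z where "z = case_sum x' (\<lambda>(e, Q). l' e Q)"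
    have "z i \<in> {0..1}" for i
      using *(1,2) by (auto simp: z_def split: sum.split)
    then have "z \<in> F"
      using *(3) unfolding F_def by (auto simp: z_def Y_def lp1_feasible_def)
    moreover have "obj z = (\<Sum>S\<in>\<S>. c S * x' S)" by (simp add: obj_def z_def)
    ultimately show ?thesis using *(4) by (intro bexI[of _ z]) simp_all
  qed
  \<comment> \<open>The cube may have infinitely many coordinates (Tychonoff), but each constraint
    and the objective involve only finite sums of coordinates, hence are continuous.\<close>
  have "compact F"
    unfolding F_def Y_def
    by (intro compact_Int_closed compact_unit_cube closed_Int closed_INT closed_Collect_eq
        closed_Collect_le ballI continuous_on_sum continuous_on_const continuous_on_product_coordinates)
  moreover have "covered E r \<S> \<noteq> {}" using inst by (simp add: mdsc_instance_def)
  then obtain x y l where "lp1_feasible E \<S> r x y l"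
    using lp1_feasible_of_cover[OF inst order_refl] by blast
  then have "F \<noteq> {}" using toF by blast
  moreover have "continuous_on F obj"
    unfolding obj_def
    by (intro continuous_on_sum continuous_on_mult continuous_on_const
        continuous_on_subset[OF continuous_on_product_coordinates]) auto
  ultimately obtain z where z: "z \<in> F" "\<And>w. w \<in> F \<Longrightarrow> obj z \<le> obj w"
    using continuous_attains_inf[of F obj] by blast
  have "lp1_optimal E \<S> c r (\<lambda>S. z (Inl S)) (Y z) (\<lambda>e Q. z (Inr (e, Q)))"
    unfolding lp1_optimal_def
  proof (intro conjI allI impI)
    show "lp1_feasible E \<S> r (\<lambda>S. z (Inl S)) (Y z) (\<lambda>e Q. z (Inr (e, Q)))"
      by (rule feasF[OF z(1)])
    fix x y l assume "lp1_feasible E \<S> r x y l"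
    then obtain w where "w \<in> F" "obj w \<le> (\<Sum>S\<in>\<S>. c S * x S)" using toF by blast
    then show "(\<Sum>S\<in>\<S>. c S * z (Inl S)) \<le> (\<Sum>S\<in>\<S>. c S * x S)"
      using z(2) by (fastforce simp: obj_def)
  qed
  then show ?thesis by blast
qed

section \<open>The classes of elements\<close>

text \<open>Here \<open>k\<close> is the floor of \<open>log 2 n\<close>. Since
  \<open>n \<ge> 32\<close> gives \<open>k \<ge> 5\<close>, the conversion to naturals and the
  subtraction in \<open>2 * k - 1\<close> lose nothing.\<close>

lemma last_class_eq:
  assumes "n \<ge> 32"
  obtains k where "k \<ge> 5" "last_class n = 2 * k - 1" "2 ^ k \<le> n" "n < 2 ^ (k + 1)"
    "real k \<le> log 2 (real n)"
proof -
  define k where "k = nat \<lfloor>log 2 (real n)\<rfloor>"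
  have ge: "5 \<le> log 2 (real n)" using assms by (simp add: le_log_iff)
  have kf: "\<lfloor>log 2 (real n)\<rfloor> = int k" using ge by (simp add: k_def)
  then have k: "real k \<le> log 2 (real n)" "log 2 (real n) < real k + 1" by linarith+
  have "k \<ge> 5" using kf ge by linarith
  moreover have "last_class n = 2 * k - 1"
    using kf by (simp add: last_class_def nat_diff_distrib)
  moreover have "real (2 ^ k) \<le> real n"
    using k(1) assms by (simp add: le_log_iff powr_realpow)
  moreover have "real n < real (2 ^ (k + 1))"
    using k(2) assms by (simp add: log_less_iff powr_add powr_realpow)
  ultimately show ?thesis using that k(1) unfolding of_nat_le_iff of_nat_less_iff by blast
qed

lemma le_two_power_minus_2: "k \<ge> 5 \<Longrightarrow> k \<le> (2::nat) ^ (k - 2)"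
proof (induction k rule: dec_induct)
  case (step m)
  then have "Suc m - 2 = Suc (m - 2)" by simp
  with step show ?case by simp
qed simp

text \<open>This fails at \<open>k = 5\<close>, where \<open>10 > 8\<close>, which is the source of
  the exceptional range of \<open>n\<close>.\<close>

lemma double_le_two_power_minus_2: "k \<ge> 6 \<Longrightarrow> 2 * k \<le> (2::nat) ^ (k - 2)"
proof (induction k rule: dec_induct)
  case (step m)
  then have "Suc m - 2 = Suc (m - 2)" by simp
  with step show ?case by simp
qed simp

text \<open>The first factor is the strict upper bound on \<open>n\<close>, so
  \<open>2 ^ (k - 2)\<close> is what remains when \<open>2 ^ I\<close> is compared with
  \<open>n\<close>.\<close>

lemma two_power_last_class:
  assumes "k \<ge> 5"
  shows "(2::real) ^ (2 * k - 1) = 2 ^ (k + 1) * 2 ^ (k - 2)"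
proof -
  have "2 * k - 1 = (k + 1) + (k - 2)" using assms by simp
  then show ?thesis by (simp only: power_add)
qed

text \<open>If no class below \<open>I = 2k - 1\<close> were admissible, then \<open>Y\<^sub>0\<close> would be empty, each of the
  other \<open>I - 1\<close> classes would carry \<open>y\<close>-mass at most \<open>1 / (2k)\<close>, and the residual class less than
  \<open>1 / k\<close>, which adds up to less than 1. Discarding \<open>Y\<^sub>0\<close> matters: for \<open>k = 5\<close> the residual mass
  can exceed \<open>1 / (2k)\<close>.\<close>

lemma admissible_class_exists:
  assumes fin: "finite E" and n: "card E \<ge> 32"
    and sum1: "(\<Sum>e\<in>E. y e) = 1" and y0: "\<And>e. e \<in> E \<Longrightarrow> 0 \<le> y e"
  shows "\<exists>i < last_class (card E). admissible_class E y i"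
proof (rule ccontr)
  assume neg: "\<not> ?thesis"
  obtain k where k: "k \<ge> 5" "last_class (card E) = 2 * k - 1" "card E < 2 ^ (k + 1)"
    using last_class_eq[OF n] by metis
  define I where "I = last_class (card E)"
  have I: "real I + 1 = 2 * real k" "I \<ge> 1" using k by (auto simp: I_def of_nat_diff)
  have small: "real (card (Y_class E y i)) < 2 ^ i / (2 * real k)" if "i < I" for i
    using neg that I by (auto simp: admissible_class_def I_def not_le)
  have yle1: "y e \<le> 1" if "e \<in> E" for e
    using member_le_sum[of e E y] that y0 fin sum1 by auto
  have finY: "finite (Y_class E y i)" for i
    using fin by (auto simp: Y_class_def)
  have cover: "E \<subseteq> (\<Union>i\<le>I. Y_class E y i)"
  proof
    fix e assume e: "e \<in> E"
    show "e \<in> (\<Union>i\<le>I. Y_class E y i)"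
    proof (cases "y e \<le> 1 / 2 ^ I")
      case True
      then show ?thesis using e by (auto simp: Y_class_def I_def)
    next
      case False
      \<comment> \<open>The least \<open>j\<close> with \<open>2 ^ -j < y e\<close> places
        \<open>e\<close> in class \<open>j - 1\<close>; it is positive because
        \<open>y e \<le> 1\<close>.\<close>
      define j where "j = (LEAST j. 1 / 2 ^ j < y e)"
      have j: "1 / 2 ^ j < y e" unfolding j_def by (rule LeastI[of _ I]) (use False in auto)
      have jI: "j \<le> I" unfolding j_def by (rule Least_le) (use False in auto)
      have "j \<noteq> 0" using j yle1[OF e] by (auto intro: ccontr)
      then obtain i where i: "j = Suc i" by (cases j) auto
      have "\<not> 1 / 2 ^ i < y e" using not_less_Least[of i "\<lambda>j. 1 / 2 ^ j < y e"] i by (simp add: j_def)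
      then have "e \<in> Y_class E y i" using e i j jI by (auto simp: Y_class_def I_def)
      then show ?thesis using i jI by auto
    qed
  qed
  have upper: "(\<Sum>e\<in>Y_class E y i. y e) \<le> real (card (Y_class E y i)) / 2 ^ i" if "i \<le> I" for i
  proof -
    have "(\<Sum>e\<in>Y_class E y i. y e) \<le> (\<Sum>e\<in>Y_class E y i. 1 / 2 ^ i)"
      by (rule sum_mono) (use that in \<open>auto simp: Y_class_def I_def split: if_splits\<close>)
    then show ?thesis by simp
  qed
  have mid: "(\<Sum>e\<in>Y_class E y i. y e) \<le> 1 / (2 * real k)" if "i < I" for i
  proof -
    have "real (card (Y_class E y i)) / 2 ^ i \<le> 1 / (2 * real k)"
      using small[OF that] k(1) by (simp add: field_simps)
    then show ?thesis using upper[of i] that by linarith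
  qed
  \<comment> \<open>A cardinality below \<open>1 / (2k) < 1\<close> is 0.\<close>
  have first: "Y_class E y 0 = {}"
  proof -
    have "real (card (Y_class E y 0)) < 1 / (2 * real k)" using small[of 0] I by simp
    also have "\<dots> < 1" using k(1) by simp
    finally show ?thesis using finY by simp
  qed
  have last: "(\<Sum>e\<in>Y_class E y I. y e) < 1 / real k"
  proof -
    \<comment> \<open>The residual mass is bounded by counting all of \<open>E\<close>: it is at
      most \<open>n / 2 ^ I < 2 ^ (k + 1) / 2 ^ I = 1 / 2 ^ (k - 2)\<close>.\<close>
    have "real (card (Y_class E y I)) \<le> real (card E)"
      using fin by (auto intro!: card_mono simp: Y_class_def)
    also have "\<dots> < 2 ^ (k + 1)"
      using k(3) by (metis of_nat_less_iff of_nat_numeral of_nat_power)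
    finally have "real (card (Y_class E y I)) / 2 ^ I < 2 ^ (k + 1) / 2 ^ I"
      by (simp add: divide_strict_right_mono)
    also have "\<dots> = 1 / 2 ^ (k - 2)"
      using two_power_last_class[OF k(1)] by (simp add: I_def k(2))
    also have "\<dots> \<le> 1 / real k"
    proof -
      have "real k \<le> 2 ^ (k - 2)"
        using le_two_power_minus_2[OF k(1)] by (metis of_nat_le_iff of_nat_numeral of_nat_power)
      then show ?thesis using k(1) by (simp add: frac_le)
    qed
    finally show ?thesis using upper[of I] by simp
  qed
  have "1 = (\<Sum>e\<in>E. y e)" using sum1 by simp
  \<comment> \<open>Covering suffices: one class containing \<open>e\<close> contributes
    \<open>y e\<close>, and all other terms are nonnegative.\<close>
  also have "\<dots> \<le> (\<Sum>e\<in>E. \<Sum>i\<le>I. if e \<in> Y_class E y i then y e else 0)"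
  proof (rule sum_mono)
    fix e assume e: "e \<in> E"
    then obtain j where j: "j \<le> I" "e \<in> Y_class E y j" using cover by blast
    show "y e \<le> (\<Sum>i\<le>I. if e \<in> Y_class E y i then y e else 0)"
      using member_le_sum[of j "{..I}" "\<lambda>i. if e \<in> Y_class E y i then y e else 0"] j y0[OF e] by simp
  qed
  also have "\<dots> = (\<Sum>i\<le>I. \<Sum>e\<in>E. if e \<in> Y_class E y i then y e else 0)"
    by (rule sum.swap)
  also have "\<dots> = (\<Sum>i\<le>I. \<Sum>e\<in>Y_class E y i. y e)"
  proof (rule sum.cong[OF refl])
    fix i
    have "Y_class E y i \<subseteq> E" by (auto simp: Y_class_def)
    then show "(\<Sum>e\<in>E. if e \<in> Y_class E y i then y e else 0) = (\<Sum>e\<in>Y_class E y i. y e)"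
      using fin by (simp add: sum.If_cases Int_absorb1)
  qed
  also have "\<dots> = (\<Sum>i\<in>{1..<I}. \<Sum>e\<in>Y_class E y i. y e) + (\<Sum>e\<in>Y_class E y I. y e)"
  proof -
    have "{..I} = insert 0 (insert I {1..<I})" using I(2) by auto
    then show ?thesis using first I(2) by simp
  qed
  also have "\<dots> < (\<Sum>i\<in>{1..<I}. 1 / (2 * real k)) + 1 / real k"
    by (intro add_le_less_mono sum_mono mid last) simp
  \<comment> \<open>There are \<open>I - 1 = 2k - 2\<close> middle classes, and
    \<open>(2k - 2) / (2k) + 1 / k = 1\<close>.\<close>
  also have "\<dots> = 1"
    using I k(1) by (simp add: of_nat_diff field_simps)
  finally show False by simp
qed

text \<open>Admissibility of the residual class gives \<open>2 ^ (2k - 1) \<le> 2k * n\<close>.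
  Together with \<open>n < 2 ^ (k + 1)\<close> this yields \<open>2 ^ (k - 2) < 2k\<close>,
  impossible for \<open>k \<ge> 6\<close>.\<close>

lemma admissible_class_less_last:
  assumes fin: "finite E" and n: "card E \<ge> 32" and adm: "admissible_class E y i"
    and exc: "i = last_class (card E) \<longrightarrow> card E \<notin> {52..63}"
  shows "i < last_class (card E)"
proof (rule ccontr)
  assume "\<not> ?thesis"
  with adm have i: "i = last_class (card E)" by (simp add: admissible_class_def)
  obtain k where k: "k \<ge> 5" "last_class (card E) = 2 * k - 1" "2 ^ k \<le> card E" "card E < 2 ^ (k + 1)"
    using last_class_eq[OF n] by metis
  have I: "real (2 * k - 1) + 1 = 2 * real k" using k(1) by (simp add: of_nat_diff)
  have "card (Y_class E y i) \<le> card E"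
    using fin by (auto intro!: card_mono simp: Y_class_def)
  then have "2 ^ (2 * k - 1) / (2 * real k) \<le> real (card E)"
    using adm i k(2) I by (simp add: admissible_class_def)
  then have le: "2 ^ (2 * k - 1) \<le> real (card E) * (2 * real k)"
    using k(1) by (simp add: field_simps)
  show False
  proof (cases "k = 5")
    \<comment> \<open>Now \<open>512 \<le> 10 * n\<close> and \<open>n < 64\<close>, which is
      precisely the excluded range.\<close>
    case True
    then have "card E \<ge> 52" using le by simp
    moreover have "card E \<le> 63" using True k(4) by simp
    ultimately show False using exc i by simp
  next
    case False
    have "real (card E) < 2 ^ (k + 1)"
      using k(4) by (metis of_nat_less_iff of_nat_numeral of_nat_power)
    then have "real (card E) * (2 * real k) < 2 ^ (k + 1) * (2 * real k)" using k(1) by simp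
    also have "\<dots> \<le> 2 ^ (k + 1) * 2 ^ (k - 2)"
    proof -
      have "2 * real k \<le> 2 ^ (k - 2)"
        using of_nat_mono[OF double_le_two_power_minus_2[of k], where 'a = real] k(1) False by simp
      then show ?thesis by simp
    qed
    finally show False using le two_power_last_class[OF k(1)] by simp
  qed
qed

section \<open>The Steiner network instance\<close>

definition star_paths :: "'a \<Rightarrow> 'a set set \<Rightarrow> 'a hnode list set" where
  "star_paths e Q = (\<lambda>S. [Root, Coll S, Elem e]) ` Q"

text \<open>Injectivity lets LP1 variables be read off from path sets through
  \<open>inv\<close>.\<close>

lemma inj_star_paths: "inj (star_paths e)"
proof (rule injI)
  fix P Q assume "star_paths e P = star_paths e Q"
  then show "P = Q" unfolding star_paths_def by (subst (asm) inj_image_eq_iff) (auto intro: injI)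
qed

lemma path_edges_three: "path_edges [a, b, c] = {{a, b}, {b, c}}"
proof -
  have "{i. Suc i < length [a, b, c]} = {0, 1}" by auto
  then have "path_edges [a, b, c] = (\<lambda>i. {[a, b, c] ! i, [a, b, c] ! Suc i}) ` {0, 1}"
    unfolding path_edges_def by blast
  then show ?thesis by simp
qed

text \<open>Both edges of the path through \<open>S\<close> contain the node \<open>Coll S\<close>,
  so paths through different sets share no edge.\<close>

lemma star_paths_mem:
  assumes Q: "Q \<in> Omega \<S> r e" and fin: "finite \<S>" and e: "e \<in> Y"
  shows "star_paths e Q \<in> disjoint_path_sets (graph (h_instance \<S> c r Y)) (r e) Root (Elem e)"
proof -
  have sub: "Q \<subseteq> \<S>" and card: "card Q = r e" and mem: "\<And>S. S \<in> Q \<Longrightarrow> e \<in> S"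
    using Q by (auto simp: Omega_def)
  have "finite (star_paths e Q)" using sub fin finite_subset by (auto simp: star_paths_def)
  moreover have "card (star_paths e Q) = r e"
    unfolding star_paths_def using card by (subst card_image) (auto intro: inj_onI)
  moreover have "is_path (graph (h_instance \<S> c r Y)) Root (Elem e) p" if "p \<in> star_paths e Q" for p
  proof -
    obtain S where "p = [Root, Coll S, Elem e]" "S \<in> \<S>" "e \<in> S"
      using \<open>p \<in> star_paths e Q\<close> sub mem by (auto simp: star_paths_def)
    then show ?thesis
      using e by (auto simp: is_path_def path_edges_three h_instance_def doubleton_eq_iff)
  qed
  moreover have "path_edges p \<inter> path_edges q = {}"
    if "p \<in> star_paths e Q" "q \<in> star_paths e Q" "p \<noteq> q" for p q
    using that by (auto simp: star_paths_def path_edges_three doubleton_eq_iff)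
  ultimately show ?thesis by (simp add: disjoint_path_sets_def)
qed

text \<open>For requirement 0 the empty path set is the only choice; it meets no node, so such pairs
  put no load on the node variables.\<close>

lemma disjoint_path_sets_0: "disjoint_path_sets G 0 u v = {{}}"
  by (auto simp: disjoint_path_sets_def)

lemma finite_disjoint_path_sets:
  assumes "finite (fst G)"
  shows "finite (disjoint_path_sets G k u v)"
proof (rule finite_subset)
  show "disjoint_path_sets G k u v \<subseteq> Pow {p. set p \<subseteq> fst G \<and> distinct p}"
    by (auto simp: disjoint_path_sets_def is_path_def)
  show "finite (Pow {p. set p \<subseteq> fst G \<and> distinct p})"
    using assms by (simp add: finite_subset_distinct)
qed

lemma h_req_cases:
  obtains e where "u = Root" "v = Elem e" "e \<in> Y" "h_req Y r u v = r e"
  | "h_req Y r u v = 0" "\<And>e. u = Root \<Longrightarrow> v = Elem e \<Longrightarrow> e \<notin> Y"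
proof (cases "\<exists>e\<in>Y. u = Root \<and> v = Elem e")
  case False
  then have "h_req Y r u v = 0" by (cases u; cases v) auto
  then show ?thesis using False that(2) by blast
qed (auto intro: that(1))

text \<open>The full graph serves as a solution. The promise of \<open>nwsn_approximates\<close>
  takes effect only once some solution is known.\<close>

lemma h_instance_solvable:
  assumes fin: "finite \<S>" and ne: "\<And>e. e \<in> Y \<Longrightarrow> Omega \<S> r e \<noteq> {}"
  shows "nwsn_solution (h_instance \<S> c r Y) (graph (h_instance \<S> c r Y))"
  unfolding nwsn_solution_def
proof (intro conjI ballI impI)
  show "subgraph (graph (h_instance \<S> c r Y)) (graph (h_instance \<S> c r Y))"
    by (auto simp: subgraph_def h_instance_def)
  fix u v :: "'a hnode"
  have req: "req (h_instance \<S> c r Y) = h_req Y r" by (simp add: h_instance_def)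
  show "disjoint_path_sets (graph (h_instance \<S> c r Y)) (req (h_instance \<S> c r Y) u v) u v \<noteq> {}"
  proof (cases rule: h_req_cases[where u = u and v = v and Y = Y and r = r])
    case (1 e)
    then obtain Q where "Q \<in> Omega \<S> r e" using ne by blast
    from star_paths_mem[OF this fin 1(3)] show ?thesis using 1 by (auto simp: req)
  next
    case 2
    then show ?thesis by (simp add: req disjoint_path_sets_0)
  qed
qed

text \<open>Sending each \<open>Q \<in> \<Omega>\<^sub>e\<close> to the paths \<open>s - S - e\<close> with \<open>S \<in> Q\<close> turns an LP1 solution, scaled so
  that every element of \<open>Y\<close> is fractionally covered once, into a solution of the network LP. The
  nodes outside \<open>\<S>\<close> have weight 0, so their variables may be as large as the constraints ask.\<close>

lemma nwsn_lp_opt_h_instance_le: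
  assumes fin: "finite \<S>" "finite Y" and c: "\<And>S. S \<in> \<S> \<Longrightarrow> 0 \<le> c S" and YE: "Y \<subseteq> E"
    and feas: "lp1_feasible E \<S> r x y l" and t: "t > 0" and y: "\<And>e. e \<in> Y \<Longrightarrow> 1 \<le> t * y e"
  shows "nwsn_lp_opt (h_instance \<S> c r Y) \<le> t * (\<Sum>S\<in>\<S>. c S * x S)"
proof -
  let ?N = "h_instance \<S> c r Y"
  let ?V = "fst (graph ?N)"
  let ?P = "\<lambda>e. disjoint_path_sets (graph ?N) (r e) Root (Elem e)"
  have V: "?V = Elem ` Y \<union> Coll ` \<S> \<union> {Root}" and req: "req ?N = h_req Y r"
    and w: "node_weight ?N = h_weight c"
    by (simp_all add: h_instance_def)
  have finV: "finite ?V" using fin by (simp add: V)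
  have finP: "finite (disjoint_path_sets (graph ?N) k u v)" for k u v
    using finite_disjoint_path_sets[OF finV] .
  have finO: "finite (Omega \<S> r e)" for e using finite_Omega[OF fin(1)] .
  have yl: "\<And>e. e \<in> Y \<Longrightarrow> y e \<le> (\<Sum>Q\<in>Omega \<S> r e. l e Q)"
    and lx: "\<And>e S. e \<in> Y \<Longrightarrow> S \<in> \<S> \<Longrightarrow> (\<Sum>Q\<in>{Q \<in> Omega \<S> r e. S \<in> Q}. l e Q) \<le> x S"
    and x0: "\<And>S. S \<in> \<S> \<Longrightarrow> 0 \<le> x S"
    and l0: "\<And>e Q. e \<in> Y \<Longrightarrow> Q \<in> Omega \<S> r e \<Longrightarrow> 0 \<le> l e Q"
    using feas YE by (auto simp: lp1_feasible_def)
  define L where "L e = (\<Sum>Q\<in>Omega \<S> r e. l e Q)" for e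
  have L0: "0 \<le> L e" if "e \<in> Y" for e
    unfolding L_def using l0[OF that] by (rule sum_nonneg)
  define X where "X v = (case v of Coll S \<Rightarrow> t * x S | _ \<Rightarrow> t * (\<Sum>e\<in>Y. L e))" for v
  \<comment> \<open>\<open>M\<close> transports \<open>l\<close> along \<open>star_paths\<close>,
    scaled by \<open>t\<close>, and vanishes on path sets of any other shape.\<close>
  define M where "M e P = (if P \<in> star_paths e ` Omega \<S> r e
      then t * l e (inv (star_paths e) P) else 0)" for e P
  \<comment> \<open>The default 1 serves the pairs of requirement 0: their empty path set must carry
    total value at least 1.\<close>
  define l' where "l' u v P = (case v of Elem e \<Rightarrow> if u = Root \<and> e \<in> Y then M e P else 1 | _ \<Rightarrow> 1)"
    for u v :: "'a hnode" and P
  have M0: "0 \<le> M e P" if "e \<in> Y" for e P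
    using l0[OF that] t by (auto simp: M_def inv_f_f[OF inj_star_paths])
  \<comment> \<open>The predicate \<open>R\<close> is instantiated with \<open>True\<close> for the
    covering constraint and with passage through a node for the capacity constraint.\<close>
  have sum_M: "(\<Sum>P\<in>{P \<in> ?P e. R P}. M e P) = t * (\<Sum>Q\<in>{Q \<in> Omega \<S> r e. R (star_paths e Q)}. l e Q)"
    if "e \<in> Y" for e R
  proof -
    let ?A = "{Q \<in> Omega \<S> r e. R (star_paths e Q)}"
    have "(\<Sum>P\<in>{P \<in> ?P e. R P}. M e P) = (\<Sum>P\<in>star_paths e ` ?A. M e P)"
    proof (rule sum.mono_neutral_right)
      show "star_paths e ` ?A \<subseteq> {P \<in> ?P e. R P}"
        using star_paths_mem[OF _ fin(1) that] by auto
    qed (use finP in \<open>auto simp: M_def\<close>)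
    also have "\<dots> = (\<Sum>Q\<in>?A. M e (star_paths e Q))"
      by (rule sum.reindex_cong[OF _ refl refl]) (rule inj_on_subset[OF inj_star_paths subset_UNIV])
    also have "\<dots> = (\<Sum>Q\<in>?A. t * l e Q)"
      by (rule sum.cong) (auto simp: M_def inv_f_f[OF inj_star_paths])
    finally show ?thesis by (simp add: sum_distrib_left)
  qed
  have X0: "0 \<le> X v" if "v \<in> ?V" for v
    using that x0 t L0 unfolding V by (auto simp: X_def intro!: mult_nonneg_nonneg sum_nonneg)
  have feasN: "nwsn_lp_feasible ?N X l'"
    unfolding nwsn_lp_feasible_def Let_def
  proof (intro conjI ballI impI)
    show "0 \<le> X v" if "v \<in> ?V" for v using X0[OF that] .
    fix u v assume uv: "u \<in> ?V" "v \<in> ?V" "u \<noteq> v"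
    let ?D = "disjoint_path_sets (graph ?N) (req ?N u v) u v"
    have "(\<forall>P\<in>?D. 0 \<le> l' u v P) \<and> 1 \<le> (\<Sum>P\<in>?D. l' u v P) \<and>
      (\<forall>z\<in>?V. (\<Sum>P\<in>{P \<in> ?D. \<exists>p\<in>P. z \<in> set p}. l' u v P) \<le> X z)"
    proof (cases rule: h_req_cases[where u = u and v = v and Y = Y and r = r])
      case (1 e)
      have D: "?D = ?P e" using 1 by (simp add: req)
      have l': "l' u v = M e" using 1 by (auto simp: l'_def)
      have "1 \<le> (\<Sum>P\<in>?P e. M e P)"
      proof -
        have "1 \<le> t * y e" using y 1 by simp
        also have "\<dots> \<le> t * L e" using yl[of e] 1 t by (simp add: L_def)
        also have "\<dots> = (\<Sum>P\<in>?P e. M e P)"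
          using sum_M[of e "\<lambda>_. True"] 1 by (simp add: L_def)
        finally show ?thesis .
      qed
      moreover have "(\<Sum>P\<in>{P \<in> ?P e. \<exists>p\<in>P. z \<in> set p}. M e P) \<le> X z" if z: "z \<in> ?V" for z
      proof (cases "\<exists>S. z = Coll S")
        case True
        then obtain S where S: "z = Coll S" "S \<in> \<S>" using z by (auto simp: V)
        have "{Q \<in> Omega \<S> r e. \<exists>p\<in>star_paths e Q. z \<in> set p} = {Q \<in> Omega \<S> r e. S \<in> Q}"
          by (auto simp: star_paths_def S)
        then show ?thesis
          using sum_M[OF 1(3), of "\<lambda>P. \<exists>p\<in>P. z \<in> set p"] lx[OF 1(3) S(2)] t by (simp add: X_def S)
      next
        case False
        have "(\<Sum>P\<in>{P \<in> ?P e. \<exists>p\<in>P. z \<in> set p}. M e P) \<le> (\<Sum>P\<in>?P e. M e P)"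
          using finP M0[OF 1(3)] by (intro sum_mono2) auto
        also have "\<dots> = t * L e"
          using sum_M[of e "\<lambda>_. True"] 1 by (simp add: L_def)
        also have "\<dots> \<le> t * (\<Sum>e\<in>Y. L e)"
          using member_le_sum[of e Y L] L0 fin 1 t by simp
        also have "\<dots> = X z" using False by (cases z) (auto simp: X_def)
        finally show ?thesis .
      qed
      ultimately show ?thesis unfolding D l' using M0[OF 1(3)] by blast
    next
      case 2
      have "l' u v P = 1" for P using 2(2) by (auto simp: l'_def split: hnode.split)
      moreover have "?D = {{}}" using 2(1) by (simp add: req disjoint_path_sets_0)
      moreover have "{P \<in> {{}}. \<exists>p\<in>P. z \<in> set p} = {}" for z :: "'a hnode" by auto
      ultimately show ?thesis using X0 by (simp only: sum.empty) simp
    qed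
    then show "\<And>P. P \<in> ?D \<Longrightarrow> 0 \<le> l' u v P" "1 \<le> (\<Sum>P\<in>?D. l' u v P)"
      "\<And>z. z \<in> ?V \<Longrightarrow> (\<Sum>P\<in>{P \<in> ?D. \<exists>p\<in>P. z \<in> set p}. l' u v P) \<le> X z"
      by blast+
  qed
  let ?O = "{(\<Sum>v\<in>?V. node_weight ?N v * x v) | x l. nwsn_lp_feasible ?N x l}"
  \<comment> \<open>A lower bound is required for \<open>Inf\<close> to lie below the value of the
    constructed point; nonnegative weights supply 0.\<close>
  have "bdd_below ?O"
  proof (rule bdd_belowI[of _ 0])
    fix a assume "a \<in> ?O"
    then obtain x' k where "a = (\<Sum>v\<in>?V. node_weight ?N v * x' v)" "nwsn_lp_feasible ?N x' k"
      by blast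
    moreover have "0 \<le> node_weight ?N v" if "v \<in> ?V" for v
      using that c by (auto simp: V w)
    ultimately show "0 \<le> a" by (auto simp: nwsn_lp_feasible_def intro!: sum_nonneg)
  qed
  then have "nwsn_lp_opt ?N \<le> (\<Sum>v\<in>?V. node_weight ?N v * X v)"
    unfolding nwsn_lp_opt_def using feasN by (intro cInf_lower) blast+
  also have "\<dots> = (\<Sum>v\<in>Coll ` \<S>. node_weight ?N v * X v)"
    by (rule sum.mono_neutral_right[OF finV]) (auto simp: V w)
  also have "\<dots> = (\<Sum>S\<in>\<S>. c S * (t * x S))"
    by (subst sum.reindex) (auto simp: w X_def intro: inj_onI)
  also have "\<dots> = t * (\<Sum>S\<in>\<S>. c S * x S)"
    by (simp add: sum_distrib_left mult.left_commute)
  finally show ?thesis .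
qed

text \<open>Edge-disjoint paths into \<open>e\<close> end in different edges, hence pass through different sets.\<close>

lemma nwsn_solution_covers:
  assumes sol: "nwsn_solution (h_instance \<S> c r Y) H" and fin: "finite \<S>" and YE: "Y \<subseteq> E"
  shows "Y \<subseteq> covered E r {S. Coll S \<in> fst H}"
proof
  fix e assume e: "e \<in> Y"
  let ?N = "h_instance \<S> c r Y"
  have "Root \<in> fst (graph ?N)" "Elem e \<in> fst (graph ?N)" "req ?N Root (Elem e) = r e"
    using e by (auto simp: h_instance_def)
  then obtain P where "P \<in> disjoint_path_sets H (r e) Root (Elem e)"
    using sol unfolding nwsn_solution_def by fastforce
  then have P: "card P = r e" "\<And>p. p \<in> P \<Longrightarrow> is_path H Root (Elem e) p"
      "\<And>p q. p \<in> P \<Longrightarrow> q \<in> P \<Longrightarrow> p \<noteq> q \<Longrightarrow> path_edges p \<inter> path_edges q = {}"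
    by (auto simp: disjoint_path_sets_def)
  have subg: "fst H \<subseteq> fst (graph ?N)" "snd H \<subseteq> snd (graph ?N)"
    using sol by (auto simp: nwsn_solution_def subgraph_def)
  have "\<exists>S. Coll S \<in> fst H \<and> e \<in> S \<and> {Coll S, Elem e} \<in> path_edges p" if "p \<in> P" for p
  proof -
    have p: "p \<noteq> []" "hd p = Root" "last p = Elem e" "set p \<subseteq> fst H" "path_edges p \<subseteq> snd H"
      using P(2)[OF \<open>p \<in> P\<close>] by (auto simp: is_path_def)
    \<comment> \<open>The last edge of \<open>p\<close> is isolated. Its other endpoint
      \<open>w\<close> must be a set node, since in this graph \<open>Elem e\<close> is adjacent
      only to sets containing \<open>e\<close>.\<close>
    obtain p1 where p1: "p = p1 @ [Elem e]" using p(1,3) by (metis append_butlast_last_id)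
    then have "p1 \<noteq> []" using p(2) by auto
    then obtain p2 w where p2: "p1 = p2 @ [w]" by (metis append_butlast_last_id)
    have "{p ! length p2, p ! Suc (length p2)} \<in> path_edges p"
      unfolding path_edges_def using p1 p2 by (intro CollectI exI[of _ "length p2"]) simp
    then have edge: "{w, Elem e} \<in> path_edges p" by (simp add: p1 p2 nth_append)
    then have "{w, Elem e} \<in> snd (graph ?N)" using p(5) subg(2) by blast
    then obtain S where "w = Coll S" "e \<in> S" by (auto simp: h_instance_def doubleton_eq_iff)
    then show ?thesis using edge p(4) p1 p2 by auto
  qed
  then obtain f where f: "\<And>p. p \<in> P \<Longrightarrow> Coll (f p) \<in> fst H \<and> e \<in> f p \<and> {Coll (f p), Elem e} \<in> path_edges p"
    by metis
  \<comment> \<open>Two paths with the same \<open>f\<close>-value would share the edge from that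
    set to \<open>Elem e\<close>.\<close>
  have "inj_on f P" using f P(3) by (intro inj_onI) (metis disjoint_iff)
  moreover have "f ` P \<subseteq> {S \<in> {S. Coll S \<in> fst H}. e \<in> S}" using f by auto
  moreover have "{S. Coll S \<in> fst H} \<subseteq> \<S>" using subg(1) by (auto simp: h_instance_def)
  then have "finite {S \<in> {S. Coll S \<in> fst H}. e \<in> S}"
    by (intro finite_subset[OF _ fin]) auto
  ultimately have "r e \<le> card {S \<in> {S. Coll S \<in> fst H}. e \<in> S}"
    using card_inj_on_le P(1) by metis
  then show "e \<in> covered E r {S. Coll S \<in> fst H}" using e YE by (auto simp: covered_def)
qed

text \<open>All nodes other than the \<open>Coll S\<close> have weight 0.\<close>

lemma cost_eq_subgraph_weight:
  assumes "nwsn_solution (h_instance \<S> c r Y) H" and "finite \<S>" and "finite Y"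
  shows "cost c {S. Coll S \<in> fst H} = subgraph_weight (h_instance \<S> c r Y) H"
proof -
  have sub: "fst H \<subseteq> Elem ` Y \<union> Coll ` \<S> \<union> {Root}"
    using assms(1) by (auto simp: nwsn_solution_def subgraph_def h_instance_def)
  then have "finite (fst H)" by (rule finite_subset) (use assms in auto)
  then have "subgraph_weight (h_instance \<S> c r Y) H = (\<Sum>v\<in>Coll ` {S. Coll S \<in> fst H}. h_weight c v)"
    unfolding subgraph_weight_def using sub
    by (intro sum.mono_neutral_cong_right) (auto simp: h_instance_def)
  also have "\<dots> = cost c {S. Coll S \<in> fst H}"
    by (subst sum.reindex) (auto simp: cost_def intro: inj_onI)
  finally show ?thesis by simp
qed

section \<open>The approximation guarantee\<close>

lemma alg2_output_eq: "alg2_output solver E \<S> c r y i =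
    {S. Coll S \<in> fst (solver (h_instance \<S> c r (Y_class E y i)))}"
  by (auto simp: alg2_output_def Let_def)

lemma alg2_output_density:
  assumes inst: "mdsc_instance E \<S> c r" and n: "card E \<ge> 32"
    and approx: "\<And>Y. Y \<subseteq> E \<Longrightarrow> nwsn_approximates solver \<rho> (h_instance \<S> c r Y)" and \<rho>: "\<rho> \<ge> 0"
    and opt: "lp1_optimal E \<S> c r x y l"
    and adm: "admissible_class E y i" and i: "i < last_class (card E)"
  defines "\<S>' \<equiv> alg2_output solver E \<S> c r y i"
  shows "\<S>' \<subseteq> \<S>" "covered E r \<S>' \<noteq> {}"
    "cost c \<S>' / real (card (covered E r \<S>')) \<le> \<rho> * (4 * log 2 (real (card E))) * opt_mdsc E \<S> c r"
proof -
  define Y where "Y = Y_class E y i"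
  define H where "H = solver (h_instance \<S> c r Y)"
  define lp where "lp = (\<Sum>S\<in>\<S>. c S * x S)"
  define m where "m = real (last_class (card E)) + 1"
  have finE: "finite E" and c: "\<And>S. S \<in> \<S> \<Longrightarrow> 0 \<le> c S"
    using inst by (auto simp: mdsc_instance_def)
  have finS: "finite \<S>" using inst by (rule finite_collection)
  have feas: "lp1_feasible E \<S> r x y l" using opt by (simp add: lp1_optimal_def)
  have YE: "Y \<subseteq> E" by (auto simp: Y_def Y_class_def)
  then have finY: "finite Y" using finE by (rule finite_subset)
  have Y_large: "1 / 2 ^ (i + 1) < y e" if "e \<in> Y" for e
    using that i by (auto simp: Y_def Y_class_def)
  \<comment> \<open>Positive \<open>y e\<close> needs some \<open>l e Q\<close> to support it, so
    every element of \<open>Y\<close> can be fully covered and the instance is solvable.\<close>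
  have "Omega \<S> r e \<noteq> {}" if "e \<in> Y" for e
  proof
    assume "Omega \<S> r e = {}"
    moreover have "y e \<le> (\<Sum>Q\<in>Omega \<S> r e. l e Q)"
      using feas that YE by (auto simp: lp1_feasible_def)
    ultimately have "y e \<le> 0" by simp
    moreover have "0 < y e" by (rule less_trans[OF _ Y_large[OF that]]) simp
    ultimately show False by simp
  qed
  from h_instance_solvable[OF finS this]
  have sol: "nwsn_solution (h_instance \<S> c r Y) H"
    and weight: "subgraph_weight (h_instance \<S> c r Y) H \<le> \<rho> * nwsn_lp_opt (h_instance \<S> c r Y)"
    using approx[OF YE] unfolding nwsn_approximates_def H_def by blast+
  have S': "\<S>' = {S. Coll S \<in> fst H}" by (simp add: \<S>'_def alg2_output_eq H_def Y_def)
  show "\<S>' \<subseteq> \<S>"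
    using sol by (auto simp: S' nwsn_solution_def subgraph_def h_instance_def)
  have m: "0 < m" "m \<le> 2 * log 2 (real (card E))"
  proof -
    obtain k where "k \<ge> 5" "last_class (card E) = 2 * k - 1" "real k \<le> log 2 (real (card E))"
      using last_class_eq[OF n] by metis
    then show "0 < m" "m \<le> 2 * log 2 (real (card E))" by (auto simp: m_def of_nat_diff)
  qed
  have Ycov: "Y \<subseteq> covered E r \<S>'" unfolding S' by (rule nwsn_solution_covers[OF sol finS YE])
  have "card Y \<le> card (covered E r \<S>')"
    using finE by (intro card_mono Ycov) (auto simp: covered_def)
  moreover have "2 ^ i / m \<le> real (card Y)"
    using adm by (simp add: admissible_class_def m_def Y_def)
  ultimately have cov: "2 ^ i / m \<le> real (card (covered E r \<S>'))" by linarith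
  have pos: "0 < 2 ^ i / m" using m(1) by simp
  then show "covered E r \<S>' \<noteq> {}" using cov by auto
  have lp0: "0 \<le> lp"
    using c feas by (auto simp: lp_def lp1_feasible_def intro!: sum_nonneg)
  have lp_opt: "lp \<le> opt_mdsc E \<S> c r"
    unfolding lp_def by (rule lp1_optimal_le_opt_mdsc[OF inst opt])
  have "nwsn_lp_opt (h_instance \<S> c r Y) \<le> 2 ^ (i + 1) * lp"
    unfolding lp_def
  proof (rule nwsn_lp_opt_h_instance_le[OF finS finY c YE feas])
    show "(0::real) < 2 ^ (i + 1)" by simp
    show "1 \<le> 2 ^ (i + 1) * y e" if "e \<in> Y" for e
      using Y_large[OF that] by (simp add: field_simps)
  qed
  then have "cost c \<S>' \<le> \<rho> * (2 ^ (i + 1) * lp)"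
    unfolding S' cost_eq_subgraph_weight[OF sol finS finY]
    using weight \<rho> by (meson mult_left_mono order_trans)
  then have "cost c \<S>' / real (card (covered E r \<S>')) \<le> \<rho> * (2 ^ (i + 1) * lp) / (2 ^ i / m)"
    using cov pos \<rho> lp0 by (intro frac_le) auto
  \<comment> \<open>The powers of two cancel up to a single factor 2; the bound
    \<open>m \<le> 2 * log 2 n\<close> then yields the constant 4.\<close>
  also have "\<dots> = \<rho> * (2 * m) * lp" by simp
  also have "\<dots> \<le> \<rho> * (4 * log 2 (real (card E))) * opt_mdsc E \<S> c r"
  proof (rule mult_mono)
    show "\<rho> * (2 * m) \<le> \<rho> * (4 * log 2 (real (card E)))"
      using m(2) \<rho> by (intro mult_left_mono) auto
  qed (use m \<rho> lp0 lp_opt in auto)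
  finally show "cost c \<S>' / real (card (covered E r \<S>')) \<le>
    \<rho> * (4 * log 2 (real (card E))) * opt_mdsc E \<S> c r" .
qed

text \<open>The constant is \<open>4 * K\<close>: the solver contributes
  \<open>K * r_max * log n\<close> and the class selection \<open>4 * log n\<close>. The existence
  of an LP1 optimum and of an admissible class below the last one keeps the guarantee from being
  vacuous.\<close>

theorem theorem3:
  fixes K :: real
  assumes "K > 0"
  shows "\<exists>C>0. \<forall>(E :: 'a set) \<S> c r solver.
    mdsc_instance E \<S> c r \<longrightarrow>
    card E \<ge> 32 \<longrightarrow>
    (\<forall>Y\<subseteq>E. nwsn_approximates solver (K * real (r_max E r) * log 2 (real (card E)))
              (h_instance \<S> c r Y)) \<longrightarrow>
    (\<exists>x y l. lp1_optimal E \<S> c r x y l) \<and>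
    (\<forall>x y l. lp1_optimal E \<S> c r x y l \<longrightarrow>
      (\<exists>i < last_class (card E). admissible_class E y i) \<and>
      (\<forall>i. admissible_class E y i \<and> (i = last_class (card E) \<longrightarrow> card E \<notin> {52..63}) \<longrightarrow>
        (let \<S>' = alg2_output solver E \<S> c r y i in
          \<S>' \<subseteq> \<S> \<and> covered E r \<S>' \<noteq> {} \<and>
          cost c \<S>' / real (card (covered E r \<S>'))
            \<le> C * real (r_max E r) * (log 2 (real (card E)))\<^sup>2 * opt_mdsc E \<S> c r)))"
proof (intro exI[of _ "4 * K"] conjI allI impI)
  show "4 * K > 0" using assms by simp
  fix E :: "'a set" and \<S> c r solver
  assume inst: "mdsc_instance E \<S> c r" and n: "card E \<ge> 32"
    and approx: "\<forall>Y\<subseteq>E. nwsn_approximates solver (K * real (r_max E r) * log 2 (real (card E)))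
              (h_instance \<S> c r Y)"
  have finE: "finite E" using inst by (simp add: mdsc_instance_def)
  show "\<exists>x y l. lp1_optimal E \<S> c r x y l" by (rule lp1_optimal_exists[OF inst])
  fix x y l assume opt: "lp1_optimal E \<S> c r x y l"
  show "\<exists>i < last_class (card E). admissible_class E y i"
    using opt by (intro admissible_class_exists[OF finE n]) (auto simp: lp1_optimal_def lp1_feasible_def)
  fix i assume "admissible_class E y i \<and> (i = last_class (card E) \<longrightarrow> card E \<notin> {52..63})"
  then have adm: "admissible_class E y i" and less: "i < last_class (card E)"
    using admissible_class_less_last[OF finE n] by auto
  have "0 \<le> K * real (r_max E r) * log 2 (real (card E))" using assms n by simp
  note alg2 = alg2_output_density[OF inst n approx[rule_format] this opt adm less]
  show "let \<S>' = alg2_output solver E \<S> c r y i in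
          \<S>' \<subseteq> \<S> \<and> covered E r \<S>' \<noteq> {} \<and>
          cost c \<S>' / real (card (covered E r \<S>'))
            \<le> 4 * K * real (r_max E r) * (log 2 (real (card E)))\<^sup>2 * opt_mdsc E \<S> c r"
    unfolding Let_def using alg2 by (simp add: power2_eq_square mult_ac)
qed

end
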